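(* There exists a constant $c>0$ and an integer $n_0$ such that for every $n\ge n_0$, the hypercube $Q_n$ contains at least $cn$ pairwise completely independent spanning trees. (That is, there are $\Omega(n)$ completely independent spanning trees in $Q_n$.)
   Context: The hypercube $Q_n$ has vertex set $\{0,1\}^n$, two vertices being adjacent if they differ in exactly one coordinate. Two spanning trees of a graph $G$ are completely independent if they have no edge in common and, for every pair of vertices $u,v$ of $G$, the $u$–$v$ paths in the two trees have no vertex in common other than $u$ and $v$. A set of spanning trees is completely independent if its members are pairwise completely independent. *)

theory Defs
  imports Complex_Main "Graph_Theory.Digraph_Component"
begin

text \<open>
  An undirected simple graph is an instance of \<^locale>\<open>pair_graph\<close>, i.e. a finite, loop-free
  symmetric digraph without parallel arcs: the edge between \<open>u\<close> and \<open>v\<close> is the pair of arcs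
  \<open>(u, v)\<close> and \<open>(v, u)\<close>.
\<close>

definition hypercube :: "nat \<Rightarrow> bool list pair_pre_digraph" where
  "hypercube n = \<lparr> pverts = {u. length u = n},
     parcs = {(u, v). length u = n \<and> length v = n \<and> card {i. i < n \<and> u ! i \<noteq> v ! i} = 1} \<rparr>"

lemma hypercube_arcs_iff:
  "(u, v) \<in> parcs (hypercube n) \<longleftrightarrow>
     length u = n \<and> length v = n \<and> card {i. i < n \<and> u ! i \<noteq> v ! i} = 1"
  unfolding hypercube_def by simp

lemma pair_graph_hypercube: "pair_graph (hypercube n)"
proof -
  have verts: "pverts (hypercube n) = {u. length u = n}"
    unfolding hypercube_def by simp
  have fin: "finite (pverts (hypercube n))"
    using finite_lists_length_eq[of "UNIV :: bool set" n] by (simp add: verts)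
  have sub: "parcs (hypercube n) \<subseteq> pverts (hypercube n) \<times> pverts (hypercube n)"
    unfolding hypercube_def by auto
  have fin_arcs: "finite (parcs (hypercube n))"
    by (rule finite_subset[OF sub]) (intro finite_cartesian_product fin)
  have sym: "sym (parcs (hypercube n))"
  proof (rule symI)
    fix u v assume uv: "(u, v) \<in> parcs (hypercube n)"
    have "{i. i < n \<and> v ! i \<noteq> u ! i} = {i. i < n \<and> u ! i \<noteq> v ! i}"
      by blast
    with uv show "(v, u) \<in> parcs (hypercube n)"
      unfolding hypercube_arcs_iff by metis
  qed
  have loop: "u \<noteq> v" if "(u, v) \<in> parcs (hypercube n)" for u v
    using that unfolding hypercube_arcs_iff by force
  show ?thesis
  proof (unfold_locales)
    show "fst e \<in> pverts (hypercube n)" if "e \<in> parcs (hypercube n)" for e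
      using that sub by force
    show "snd e \<in> pverts (hypercube n)" if "e \<in> parcs (hypercube n)" for e
      using that sub by force
    show "finite (pverts (hypercube n))" by (rule fin)
    show "finite (parcs (hypercube n))" by (rule fin_arcs)
    show "fst e \<noteq> snd e" if "e \<in> parcs (hypercube n)" for e
      using that loop[of "fst e" "snd e"] by simp
    show "symmetric (with_proj (hypercube n))"
      unfolding symmetric_def with_proj_simps by (rule sym)
  qed
qed

text \<open>
  The library predicate \<^const>\<open>forest\<close> forbids directed cycles only. It rejects every symmetric
  digraph with an arc, since \<open>u, v, u\<close> is a directed cycle, and it accepts acyclic orientations of
  arbitrary graphs. In a symmetric simple digraph, the cycles of the underlying undirected graph
  are the directed cycles of length at least 3.
\<close>

definition undirected_tree :: "'a pair_pre_digraph \<Rightarrow> bool" where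
  "undirected_tree T \<longleftrightarrow> pair_graph T \<and> Digraph_Component.connected (with_proj T) \<and>
     \<not> (\<exists>p. pre_digraph.cycle (with_proj T) p \<and> length p \<ge> 3)"

definition undirected_spanning_tree :: "'a pair_pre_digraph \<Rightarrow> 'a pair_pre_digraph \<Rightarrow> bool" where
  "undirected_spanning_tree T G \<longleftrightarrow> undirected_tree T \<and> spanning (with_proj T) (with_proj G)"

text \<open>
  The \<open>u\<close>--\<open>v\<close> path in a tree exists and is unique, so quantifying over all such paths
  amounts to speaking about that path.
\<close>

definition completely_independent ::
    "'a pair_pre_digraph \<Rightarrow> 'a pair_pre_digraph \<Rightarrow> 'a pair_pre_digraph \<Rightarrow> bool" where
  "completely_independent G T1 T2 \<longleftrightarrow>
     parcs T1 \<inter> parcs T2 = {} \<and>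
     (\<forall>u \<in> pverts G. \<forall>v \<in> pverts G. \<forall>p q.
        pre_digraph.apath (with_proj T1) u p v \<longrightarrow>
        pre_digraph.apath (with_proj T2) u q v \<longrightarrow>
        set (pawalk_verts u p) \<inter> set (pawalk_verts u q) \<subseteq> {u, v})"

definition completely_independent_spanning_trees ::
    "'a pair_pre_digraph \<Rightarrow> 'a pair_pre_digraph set \<Rightarrow> bool" where
  "completely_independent_spanning_trees G S \<longleftrightarrow>
     (\<forall>T \<in> S. undirected_spanning_tree T G) \<and> pairwise (completely_independent G) S"

end

theory Submission
  imports Defs
begin

text \<open>
  If the vertices are coloured so that every colour class is connected and every vertex has a
  neighbour in every other class, then a spanning tree of a class, with all other vertices attached
  as leaves, is a spanning tree of the graph whose inner vertices lie in that class. Such trees for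
  different classes are completely independent as soon as no edge attaches both of its ends.

  Hamming syndromes give a colouring with \<open>2 ^ m\<close> colours in which every vertex sees every colour,
  but the classes are cosets of a code and hence far from connected. So two syndromes on disjoint
  sets of coordinates are used, and coordinate 0 decides which of them is the colour. In either half
  the coordinates of the other syndrome can be changed freely within a class, and moving back and
  forth between the halves connects the class. Every label is given to two coordinates, so that
  conflicts between the leaf edges can be avoided; \<open>4 * 2 ^ m\<close> coordinates suffice.
\<close>

section \<open>Trees given by parents\<close>

lemma pcas_succ:
  assumes "pcas u p v" "k < length p"
  shows "snd (p ! k) = (if Suc k < length p then fst (p ! Suc k) else v)"
  using assms by (induction p arbitrary: u k) (auto simp: nth_Cons split: nat.splits elim: pcas.elims)

lemma pcas_hd: "pcas u p v \<Longrightarrow> p \<noteq> [] \<Longrightarrow> fst (p ! 0) = u"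
  by (cases p) auto

lemma tl_pawalk_verts: "pcas u p v \<Longrightarrow> tl (pawalk_verts u p) = map snd p"
proof (induction p arbitrary: u)
  case (Cons e p)
  then show ?case by (cases p) auto
qed simp

lemma set_pawalk_verts: "pcas u p v \<Longrightarrow> set (pawalk_verts u p) = insert u (snd ` set p)"
  by (induction p arbitrary: u) auto

text \<open>Since \<open>d\<close> drops along \<open>par\<close>, every chain of parents ends in
  \<open>r\<close>. Induction on \<open>d\<close> gives connectedness, and a vertex of maximal
  \<open>d\<close> excludes cycles.\<close>

locale parent_tree =
  fixes V :: "'a set" and r :: 'a and par :: "'a \<Rightarrow> 'a" and d :: "'a \<Rightarrow> nat"
  assumes finite_V: "finite V" and root: "r \<in> V"
    and par_in: "v \<in> V \<Longrightarrow> v \<noteq> r \<Longrightarrow> par v \<in> V"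
    and par_less: "v \<in> V \<Longrightarrow> v \<noteq> r \<Longrightarrow> d (par v) < d v"
begin

definition T :: "'a pair_pre_digraph" where
  "T = \<lparr>pverts = V, parcs = {(u, v). u \<in> V \<and> v \<in> V \<and> (u \<noteq> r \<and> v = par u \<or> v \<noteq> r \<and> u = par v)}\<rparr>"

lemma pverts_T [simp]: "pverts T = V"
  by (simp add: T_def)

lemma arc_T_iff:
  "(u, v) \<in> parcs T \<longleftrightarrow> u \<in> V \<and> v \<in> V \<and> (u \<noteq> r \<and> v = par u \<or> v \<noteq> r \<and> u = par v)"
  by (simp add: T_def)

lemma pair_graph_T: "pair_graph T"
proof
  have "parcs T \<subseteq> V \<times> V"
    by (auto simp: arc_T_iff)
  then show "finite (parcs T)"
    using finite_V by (meson finite_SigmaI finite_subset)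
  show "fst e \<noteq> snd e" if "e \<in> parcs T" for e
    using that par_less by (cases e) (force simp: arc_T_iff)
  show "symmetric (with_proj T)"
    by (auto simp: symmetric_def sym_def arc_T_iff)
qed (auto simp: T_def finite_V)

sublocale T: pair_graph T
  by (rule pair_graph_T)

lemma reachable_root: "v \<in> V \<Longrightarrow> v \<rightarrow>\<^sup>*\<^bsub>with_proj T\<^esub> r"
proof (induction "d v" arbitrary: v rule: less_induct)
  case less
  show ?case
  proof (cases "v = r")
    case False
    then have "(v, par v) \<in> parcs T" "par v \<rightarrow>\<^sup>*\<^bsub>with_proj T\<^esub> r"
      using less par_in par_less by (auto simp: arc_T_iff)
    then show ?thesis
      by (simp add: T.adj_reachable_trans)
  qed (simp add: root T.reachable_refl)
qed

lemma connected_T: "Digraph_Component.connected (with_proj T)"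
  unfolding connected_def
proof
  show "u \<rightarrow>\<^sup>*\<^bsub>with_proj (mk_symmetric (with_proj T))\<^esub> v"
    if "u \<in> verts (with_proj (mk_symmetric (with_proj T)))"
       "v \<in> verts (with_proj (mk_symmetric (with_proj T)))" for u v
  proof (rule T.reachable_mk_symmetricI)
    have "u \<rightarrow>\<^sup>*\<^bsub>with_proj T\<^esub> r" "r \<rightarrow>\<^sup>*\<^bsub>with_proj T\<^esub> v"
      using that reachable_root symmetric_reachable[OF T.sym_arcs] by auto
    then show "u \<rightarrow>\<^sup>*\<^bsub>with_proj T\<^esub> v"
      by (rule T.reachable_trans)
  qed
qed (use root in auto)

lemma arc_T_up: "(u, v) \<in> parcs T \<Longrightarrow> d v \<le> d u \<Longrightarrow> v = par u"
  using par_less by (auto simp: arc_T_iff dest: leD)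

text \<open>Both neighbours on a cycle of a vertex of maximal rank would be its parent.\<close>

lemma acyclic_T:
  assumes "T.cycle p" shows "length p < 3"
proof (rule ccontr)
  assume len: "\<not> length p < 3"
  define n where "n = length p"
  have n: "n \<ge> 3" using len by (simp add: n_def)
  from assms obtain u where walk: "T.awalk u p u" and dist: "distinct (tl (pawalk_verts u p))"
    unfolding T.cycle_def by auto
  then have cas: "pcas u p u" and arcs: "set p \<subseteq> parcs T"
    by (auto simp: T.awalk_def)
  have dist: "distinct (map snd p)"
    using dist tl_pawalk_verts[OF cas] by simp
  have succ: "snd (p ! k) = fst (p ! (Suc k mod n))" if "k < n" for k
  proof (cases "Suc k < n")
    case False
    then have "Suc k = n" using that by simp
    then show ?thesis
      using pcas_succ[OF cas, of k] pcas_hd[OF cas] n that unfolding n_def by force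
  qed (use pcas_succ[OF cas, of k] in \<open>simp add: n_def\<close>)
  have arc: "(fst (p ! k), snd (p ! k)) \<in> parcs T" if "k < n" for k
    using that arcs by (simp add: n_def subset_code(1))
  define M where "M = Max ((\<lambda>k. d (snd (p ! k))) ` {..<n})"
  have "M \<in> (\<lambda>k. d (snd (p ! k))) ` {..<n}"
    unfolding M_def using n by (intro Max_in) (auto simp: lessThan_empty_iff)
  then obtain k where k: "k < n" "d (snd (p ! k)) = M"
    by auto
  have max: "d (snd (p ! l)) \<le> M" if "l < n" for l
    unfolding M_def using that by (intro Max_ge) auto
  \<comment> \<open>The cyclic predecessor and successor of \<open>k\<close>. Adding
    \<open>n\<close> before subtracting 1 covers \<open>k = 0\<close>, and \<open>n \<ge> 3\<close>
    makes the two differ.\<close>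
  define a b where "a = (k + n - 1) mod n" and "b = Suc k mod n"
  have ab: "a < n" "b < n" "Suc a mod n = k" "a \<noteq> b"
    using n k(1) unfolding a_def b_def by (auto simp: mod_Suc mod_if)
  have "(snd (p ! k), snd (p ! b)) \<in> parcs T"
    using arc[OF ab(2)] succ[OF k(1)] by (simp add: b_def)
  then have "snd (p ! b) = par (snd (p ! k))"
    using max[OF ab(2)] k(2) by (simp add: arc_T_up)
  moreover have "(snd (p ! k), snd (p ! a)) \<in> parcs T"
    using arc[OF k(1)] succ[OF ab(1)] ab(3) T.arcs_symmetric by simp
  then have "snd (p ! a) = par (snd (p ! k))"
    using max[OF ab(1)] k(2) by (simp add: arc_T_up)
  ultimately show False
    using nth_eq_iff_index_eq[OF dist, of a b] ab by (simp add: n_def)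
qed

lemma undirected_tree_T: "undirected_tree T"
  unfolding undirected_tree_def using pair_graph_T connected_T acyclic_T by (meson not_le)

text \<open>An inner vertex has two distinct neighbours on the path. At most one of them is its own
  parent, so the other is a child. Hence leaves occur only as ends of paths.\<close>

lemma inner_vertex_is_parent:
  assumes path: "T.apath u p v" and w: "w \<in> set (pawalk_verts u p)" "w \<noteq> u" "w \<noteq> v"
  shows "w \<in> par ` (V - {r})"
proof (rule ccontr)
  assume np: "w \<notin> par ` (V - {r})"
  have walk: "pcas u p v" "set p \<subseteq> parcs T"
    using path by (auto simp: T.apath_def T.awalk_def)
  then obtain x where "(x, w) \<in> set p"
    using w set_pawalk_verts by force
  then obtain p1 z p2 where "p = p1 @ (x, w) # (w, z) # p2" "x \<noteq> z"
    using T.apath_succ_decomp[OF path] w by blast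
  then have "(x, w) \<in> parcs T" "(w, z) \<in> parcs T" "x \<noteq> z"
    using walk by auto
  then show False
    using np by (auto simp: arc_T_iff)
qed

end

section \<open>Spanning trees from colourings\<close>

text \<open>The last step of a shortest path starts at a vertex strictly nearer to \<open>r\<close>.
  This provides the parents of a breadth-first tree inside a colour class.\<close>

lemma rtrancl_distance_decreases:
  assumes "(r, v) \<in> R\<^sup>*" "v \<noteq> r"
  shows "\<exists>u. (u, v) \<in> R \<and> (LEAST k. (r, u) \<in> R ^^ k) < (LEAST k. (r, v) \<in> R ^^ k)"
proof -
  define k where "k = (LEAST k. (r, v) \<in> R ^^ k)"
  have k: "(r, v) \<in> R ^^ k"
    using rtrancl_imp_relpow[OF assms(1)] unfolding k_def by (auto intro: LeastI)
  then obtain l where l: "k = Suc l"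
    using assms(2) by (cases k) auto
  then obtain u where "(r, u) \<in> R ^^ l" "(u, v) \<in> R"
    using k by auto
  then show ?thesis
    using l unfolding k_def[symmetric] by (meson Least_le le_imp_less_Suc)
qed

lemma completely_independent_spanning_trees_of_colouring:
  fixes col :: "'a \<Rightarrow> 'c" and f :: "'c \<Rightarrow> 'a \<Rightarrow> 'a"
  assumes G: "pair_graph G" and fin: "finite I"
    and inhabited: "\<And>i. i \<in> I \<Longrightarrow> \<exists>r \<in> pverts G. col r = i"
    and conn: "\<And>i u v. \<lbrakk>i \<in> I; u \<in> pverts G; v \<in> pverts G; col u = i; col v = i\<rbrakk>
      \<Longrightarrow> (u, v) \<in> {(x, y) \<in> parcs G. col x = i \<and> col y = i}\<^sup>*"
    and attach: "\<And>i v. \<lbrakk>i \<in> I; v \<in> pverts G; col v \<noteq> i\<rbrakk>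
      \<Longrightarrow> (v, f i v) \<in> parcs G \<and> col (f i v) = i"
    and no_conflict: "\<And>i v. \<lbrakk>i \<in> I; v \<in> pverts G; col v \<in> I; col v \<noteq> i\<rbrakk>
      \<Longrightarrow> f (col v) (f i v) \<noteq> v"
  shows "\<exists>S. finite S \<and> completely_independent_spanning_trees G S \<and> card S = card I"
proof -
  interpret G: pair_graph G by (rule G)
  define R where "R i = {(x, y) \<in> parcs G. col x = i \<and> col y = i}" for i
  obtain r where r: "\<And>i. i \<in> I \<Longrightarrow> r i \<in> pverts G \<and> col (r i) = i"
    using inhabited by metis
  define dist where "dist i v = (LEAST k. (r i, v) \<in> R i ^^ k)" for i v
  define par where "par i v = (if col v = i then SOME u. (u, v) \<in> R i \<and> dist i u < dist i v
    else f i v)" for i v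
  define d where "d i v = (if col v = i then dist i v else Suc (dist i (f i v)))" for i v
  have inside: "(par i v, v) \<in> R i \<and> dist i (par i v) < dist i v"
    if "i \<in> I" "v \<in> pverts G" "v \<noteq> r i" "col v = i" for i v
  proof -
    have "(r i, v) \<in> (R i)\<^sup>*"
      using conn r that unfolding R_def by blast
    then have "\<exists>u. (u, v) \<in> R i \<and> dist i u < dist i v"
      using rtrancl_distance_decreases that(3) unfolding dist_def by metis
    then show ?thesis
      using that(4) someI_ex[of "\<lambda>u. (u, v) \<in> R i \<and> dist i u < dist i v"] by (simp add: par_def)
  qed
  have parent: "(v, par i v) \<in> parcs G \<and> col (par i v) = i \<and> d i (par i v) < d i v"
    if "i \<in> I" "v \<in> pverts G" "v \<noteq> r i" for i v
  proof (cases "col v = i")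
    case True
    then show ?thesis
      using inside[OF that] by (auto simp: R_def d_def intro: G.arcs_symmetric)
  next
    case False
    then show ?thesis
      using attach that by (auto simp: par_def d_def)
  qed
  have tree: "parent_tree (pverts G) (r i) (par i) (d i)" if "i \<in> I" for i
  proof
    show "finite (pverts G)" "r i \<in> pverts G"
      using G.pair_finite_verts r[OF that] by simp_all
    show "par i v \<in> pverts G" "d i (par i v) < d i v" if "v \<in> pverts G" "v \<noteq> r i" for v
      using parent[OF \<open>i \<in> I\<close> that] by (auto dest: G.in_arcsD2)
  qed
  define T where "T i = parent_tree.T (pverts G) (r i) (par i)" for i
  have arcs: "(u, v) \<in> parcs (T i) \<longleftrightarrow> u \<in> pverts G \<and> v \<in> pverts G \<and>
      (u \<noteq> r i \<and> v = par i u \<or> v \<noteq> r i \<and> u = par i v)" if "i \<in> I" for i u v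
    unfolding T_def by (rule parent_tree.arc_T_iff[OF tree[OF that]])
  have verts: "pverts (T i) = pverts G" if "i \<in> I" for i
    unfolding T_def by (rule parent_tree.pverts_T[OF tree[OF that]])
  have spanning: "undirected_spanning_tree (T i) G" if "i \<in> I" for i
  proof -
    interpret Ti: pair_graph "T i"
      unfolding T_def by (rule parent_tree.pair_graph_T[OF tree[OF that]])
    have "undirected_tree (T i)"
      unfolding T_def by (rule parent_tree.undirected_tree_T[OF tree[OF that]])
    moreover have "(u, v) \<in> parcs G" if uv: "(u, v) \<in> parcs (T i)" for u v
      using uv[unfolded arcs[OF \<open>i \<in> I\<close>]] parent[OF \<open>i \<in> I\<close>, of u] parent[OF \<open>i \<in> I\<close>, of v]
        G.arcs_symmetric by auto
    then have "parcs (T i) \<subseteq> parcs G"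
      by auto
    then have "subgraph (with_proj (T i)) (with_proj G)"
      unfolding subgraph_def using verts[OF that] by (auto intro: G.wf_digraph Ti.wf_digraph)
    ultimately show ?thesis
      using verts[OF that] by (simp add: undirected_spanning_tree_def spanning_def)
  qed
  \<comment> \<open>A child with the same parent in both trees is impossible, because the parents
    have colours \<open>i\<close> and \<open>j\<close>. What remains is an edge whose ends are each
    other's parents, one in each tree. The colours then make it a leaf edge in both, which
    \<open>no_conflict\<close> excludes.\<close>
  have no_common_arc: False
    if "i \<in> I" "j \<in> I" "i \<noteq> j" "v \<in> pverts G" "v \<noteq> r i" "par i v \<noteq> r j"
       "par j (par i v) = v" for i j v
  proof -
    have v: "par i v \<in> pverts G" "col (par i v) = i" "col v = j"
      using that parent[of i v] parent[of j "par i v"] G.in_arcsD2 by auto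
    then show False
      using that no_conflict[of i v] by (auto simp: par_def split: if_splits)
  qed
  have disjoint: "parcs (T i) \<inter> parcs (T j) = {}" if ij: "i \<in> I" "j \<in> I" "i \<noteq> j" for i j
  proof -
    have False if uv: "(u, v) \<in> parcs (T i)" "(u, v) \<in> parcs (T j)" for u v
    proof -
      have "u \<in> pverts G" "v \<in> pverts G"
        and "u \<noteq> r i \<and> v = par i u \<or> v \<noteq> r i \<and> u = par i v"
        and "u \<noteq> r j \<and> v = par j u \<or> v \<noteq> r j \<and> u = par j v"
        using uv ij by (simp_all add: arcs)
      moreover have "par i w \<noteq> par j w" if "w \<in> pverts G" "w \<noteq> r i" "w \<noteq> r j" for w
        using parent[OF ij(1) that(1,2)] parent[OF ij(2) that(1,3)] ij(3) by auto
      ultimately show False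
        using no_common_arc[OF ij, of u] no_common_arc[OF ij, of v] by auto
    qed
    then show ?thesis
      by auto
  qed
  have inner: "col w = i"
    if "i \<in> I" "pre_digraph.apath (with_proj (T i)) u p v" "w \<in> set (pawalk_verts u p)"
      "w \<noteq> u" "w \<noteq> v" for i u v p w
  proof -
    have "w \<in> par i ` (pverts G - {r i})"
      using parent_tree.inner_vertex_is_parent[OF tree] that unfolding T_def by blast
    then show ?thesis
      using parent that(1) by auto
  qed
  have ci: "completely_independent G (T i) (T j)" if "i \<in> I" "j \<in> I" "i \<noteq> j" for i j
    unfolding completely_independent_def using disjoint[OF that] inner that by blast
  have inj: "inj_on T I"
  proof (rule inj_onI, rule ccontr)
    fix i j assume ij: "i \<in> I" "j \<in> I" "T i = T j" "i \<noteq> j"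
    \<comment> \<open>Arc-disjoint trees could coincide only if they had no arcs, but
      \<open>r i\<close> has a parent in \<open>T j\<close>.\<close>
    then have "r i \<noteq> r j"
      using r by metis
    then have "(r i, par j (r i)) \<in> parcs (T j)"
      using ij r parent[of j "r i"] G.in_arcsD2 by (auto simp: arcs)
    then show False
      using disjoint[OF ij(1,2,4)] ij(3) by auto
  qed
  have "completely_independent_spanning_trees G (T ` I)"
    unfolding completely_independent_spanning_trees_def pairwise_def
    using spanning ci by blast
  then show ?thesis
    using fin card_image[OF inj] by (intro exI[of _ "T ` I"]) auto
qed

section \<open>A colouring of the hypercube\<close>

definition flip :: "nat \<Rightarrow> bool list \<Rightarrow> bool list" where
  "flip p x = x[p := \<not> x ! p]"

lemma length_flip [simp]: "length (flip p x) = length x"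
  by (simp add: flip_def)

lemma nth_flip: "p < length x \<Longrightarrow> flip p x ! q = (if q = p then \<not> x ! p else x ! q)"
  by (simp add: flip_def nth_list_update)

lemma hypercube_arc_flip: "length x = n \<Longrightarrow> p < n \<Longrightarrow> (x, flip p x) \<in> parcs (hypercube n)"
proof -
  assume "length x = n" "p < n"
  then have "{i. i < n \<and> x ! i \<noteq> flip p x ! i} = {p}"
    by (auto simp: nth_flip)
  then show ?thesis
    using \<open>length x = n\<close> by (simp add: hypercube_arcs_iff)
qed

text \<open>Numbers stand for bit vectors over the field with two elements, with \<open>xor\<close>
  as addition. This is the parity-check matrix with columns \<open>l 0\<close>, \<open>l 1\<close>,
  ... applied to \<open>x\<close>.\<close>

fun syndrome :: "(nat \<Rightarrow> nat) \<Rightarrow> bool list \<Rightarrow> nat" where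
  "syndrome l [] = 0"
| "syndrome l (b # x) = xor (if b then l 0 else 0) (syndrome (\<lambda>p. l (Suc p)) x)"

lemma syndrome_flip: "p < length x \<Longrightarrow> syndrome l (flip p x) = xor (l p) (syndrome l x)"
proof (induction x arbitrary: l p)
  case (Cons b x)
  show ?case
  proof (cases p)
    case 0
    then show ?thesis
      by (simp add: flip_def xor.assoc[symmetric])
  next
    case (Suc q)
    then have "syndrome l (flip p (b # x)) =
        xor (if b then l 0 else 0) (xor (l p) (syndrome (\<lambda>p. l (Suc p)) x))"
      using Cons by (simp add: flip_def)
    then show ?thesis
      by (simp add: xor.left_commute)
  qed
qed simp

lemma syndrome_cong:
  "length x = length y \<Longrightarrow> (\<And>p. p < length x \<Longrightarrow> l p \<noteq> 0 \<Longrightarrow> x ! p = y ! p)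
    \<Longrightarrow> syndrome l x = syndrome l y"
proof (induction x y arbitrary: l rule: list_induct2)
  case (Cons b x c y)
  have IH: "syndrome (\<lambda>p. l (Suc p)) x = syndrome (\<lambda>p. l (Suc p)) y"
    using Cons.prems[of "Suc _"] by (intro Cons.IH) auto
  have "l 0 \<noteq> 0 \<Longrightarrow> b = c"
    using Cons.prems[of 0] by simp
  then show ?case
    using IH by (cases "l 0 = 0") auto
qed simp

lemma xor_less_two_power:
  assumes "a < 2 ^ m" "b < 2 ^ m" shows "xor a b < (2 ^ m :: nat)"
  using assms by (metis take_bit_nat_eq_self_iff take_bit_xor)

lemma syndrome_less: "(\<And>p. l p < 2 ^ m) \<Longrightarrow> syndrome l x < 2 ^ m"
  by (induction x arbitrary: l) (simp_all add: xor_less_two_power)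

lemma flip_flip_neq: "p < length x \<Longrightarrow> q < length x \<Longrightarrow> p \<noteq> q \<Longrightarrow> flip q (flip p x) \<noteq> x"
  by (metis length_flip nth_flip)

text \<open>
  The coordinates with index congruent to \<open>s\<close> modulo 2 carry the nonzero labels that count in the
  half \<open>x ! 0 = s\<close> of the cube. Every label below \<open>2 ^ m\<close> occurs there at \<open>coord s False t\<close>
  and \<open>coord s True t\<close>. Coordinate 0 has label 0 in both halves.
\<close>

definition label :: "nat \<Rightarrow> bool \<Rightarrow> nat \<Rightarrow> nat" where
  "label m s p = (if odd p = s then p div 4 mod 2 ^ m else 0)"

definition coord :: "bool \<Rightarrow> bool \<Rightarrow> nat \<Rightarrow> nat" where
  "coord s c t = 4 * t + 2 * of_bool c + of_bool s"

definition colour :: "nat \<Rightarrow> bool list \<Rightarrow> nat" where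
  "colour m x = syndrome (label m (x ! 0)) x"

lemma label_0 [simp]: "label m s 0 = 0"
  by (simp add: label_def)

lemma label_less: "label m s p < 2 ^ m"
  by (simp add: label_def)

lemma label_coord: "t < 2 ^ m \<Longrightarrow> label m s' (coord s c t) = (if s' = s then t else 0)"
  by (cases s; cases c) (auto simp: label_def coord_def)

lemma label_disjoint: "label m s p \<noteq> 0 \<Longrightarrow> label m (\<not> s) p = 0"
  by (auto simp: label_def split: if_splits)

lemma coord_less: "t < 2 ^ m \<Longrightarrow> 4 * 2 ^ m \<le> n \<Longrightarrow> coord s c t < n"
  unfolding coord_def by (cases s; cases c) auto

lemma colour_less: "colour m x < 2 ^ m"
  by (simp add: colour_def syndrome_less label_less)

section \<open>Connectedness of the colour classes\<close>

definition class_arcs :: "nat \<Rightarrow> nat \<Rightarrow> nat \<Rightarrow> bool list rel" where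
  "class_arcs m n i = {(x, y) \<in> parcs (hypercube n). colour m x = i \<and> colour m y = i}"

lemma sym_class_arcs: "sym (class_arcs m n i)"
proof -
  interpret pair_graph "hypercube n"
    by (rule pair_graph_hypercube)
  show ?thesis
    by (auto simp: class_arcs_def intro!: symI arcs_symmetric)
qed

text \<open>Within a half, coordinates of label 0 do not affect the colour. They can therefore be
  overwritten one at a time, from left to right, without leaving the class.\<close>

lemma class_path_free_coordinates:
  assumes len: "length x = n" "length y = n" and zero: "x ! 0 = y ! 0" "n > 0"
    and col: "colour m x = i"
    and agree: "\<And>p. p < n \<Longrightarrow> label m (x ! 0) p \<noteq> 0 \<Longrightarrow> x ! p = y ! p"
  shows "(x, y) \<in> (class_arcs m n i)\<^sup>*"
proof -
  define w where "w k = take k y @ drop k x" for k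
  have len_w: "length (w k) = n" if "k \<le> n" for k
    using len that by (simp add: w_def)
  have nth_w: "w k ! p = (if p < k then y ! p else x ! p)" if "k \<le> n" "p < n" for k p
    using len that by (auto simp: w_def nth_append)
  have col_w: "colour m (w k) = i" if "k \<le> n" for k
  proof -
    have "w k ! 0 = x ! 0"
      using nth_w[OF that zero(2)] zero(1) by simp
    moreover have "syndrome (label m (x ! 0)) (w k) = syndrome (label m (x ! 0)) x"
      using len len_w[OF that] nth_w[OF that] agree by (intro syndrome_cong) auto
    ultimately show ?thesis
      using col by (simp add: colour_def)
  qed
  have "(x, w k) \<in> (class_arcs m n i)\<^sup>*" if "k \<le> n" for k
    using that
  proof (induction k)
    case 0
    then show ?case by (simp add: w_def)
  next
    case (Suc k)
    have "w (Suc k) = (if x ! k = y ! k then w k else flip k (w k))"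
      using Suc.prems len_w[of k] len_w[of "Suc k"]
      by (intro nth_equalityI) (auto simp: nth_w nth_flip less_Suc_eq)
    moreover have "(w k, flip k (w k)) \<in> parcs (hypercube n)"
      using Suc.prems len_w by (simp add: hypercube_arc_flip)
    ultimately have "(w k, w (Suc k)) \<in> (class_arcs m n i)\<^sup>*"
      using Suc.prems col_w[of k] col_w[of "Suc k"] by (auto simp: class_arcs_def split: if_splits)
    then show ?case
      using Suc by auto
  qed
  from this[of n] show ?thesis
    using len by (simp add: w_def)
qed

text \<open>The vertices at which a walk can change halves inside class \<open>i\<close>: coordinate
  0 has label 0, so flipping it leaves both syndromes equal to \<open>i\<close>.\<close>

definition pivot :: "nat \<Rightarrow> nat \<Rightarrow> bool list \<Rightarrow> bool" where
  "pivot m i x \<longleftrightarrow> (\<forall>s. syndrome (label m s) x = i)"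

lemma colour_pivot: "pivot m i x \<Longrightarrow> colour m x = i"
  by (simp add: pivot_def colour_def)

lemma pivot_update_0: "pivot m i (x[0 := b]) \<longleftrightarrow> pivot m i x"
proof -
  have "syndrome (label m s) (x[0 := b]) = syndrome (label m s) x" for s
  proof (rule syndrome_cong)
    show "x[0 := b] ! p = x ! p" if "label m s p \<noteq> 0" for p
      using that by (cases "p = 0") auto
  qed simp
  then show ?thesis
    by (simp add: pivot_def)
qed

lemma class_path_update_0:
  assumes "pivot m i x" "length x = n" "n > 0"
  shows "(x, x[0 := b]) \<in> (class_arcs m n i)\<^sup>*"
proof (cases "x ! 0 = b")
  case False
  then have "x[0 := b] = flip 0 x"
    by (auto simp: flip_def)
  then show ?thesis
    using assms colour_pivot[of m i x] colour_pivot[of m i "x[0 := b]"] pivot_update_0[of m i x b]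
      hypercube_arc_flip[of x n 0]
    by (auto simp: class_arcs_def)
next
  case True
  then have "x[0 := b] = x"
    using list_update_id[of x 0] by simp
  then show ?thesis
    by simp
qed

lemma class_path_pivots:
  assumes x: "pivot m i x" "length x = n" and y: "pivot m i y" "length y = n" and n: "n > 0"
  shows "(x, y) \<in> (class_arcs m n i)\<^sup>*"
proof -
  \<comment> \<open>The labels of the two halves have disjoint supports, so \<open>w\<close> can
    agree with \<open>y\<close> on one and with \<open>x\<close> on the other. The walk changes
    \<open>x\<close> into \<open>w\<close> in the half \<open>False\<close>, where the
    \<open>True\<close> labels are free, then switches halves and changes \<open>w\<close> into
    \<open>y\<close>.\<close>
  define w where "w = map (\<lambda>p. if label m True p \<noteq> 0 then y ! p else x ! p) [0..<n]"
  have len_w: "length w = n" and nth_w: "\<And>p. p < n \<Longrightarrow> w ! p = (if label m True p \<noteq> 0 then y ! p else x ! p)"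
    by (simp_all add: w_def)
  have "syndrome (label m True) w = syndrome (label m True) y"
    using len_w nth_w y by (intro syndrome_cong) auto
  moreover have "syndrome (label m False) w = syndrome (label m False) x"
    using len_w nth_w x label_disjoint[of m True] by (intro syndrome_cong) auto
  ultimately have w: "pivot m i w"
    using x y by (auto simp: pivot_def all_bool_eq)
  have "(x, x[0 := False]) \<in> (class_arcs m n i)\<^sup>*"
    using x n by (rule class_path_update_0)
  also have "(x[0 := False], w[0 := False]) \<in> (class_arcs m n i)\<^sup>*"
    using x n len_w nth_w label_disjoint[of m True]
    by (intro class_path_free_coordinates colour_pivot) (auto simp: pivot_update_0 nth_list_update)
  also have "(w[0 := False], w[0 := False, 0 := True]) \<in> (class_arcs m n i)\<^sup>*"
    using w n len_w by (intro class_path_update_0) (auto simp: pivot_update_0)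
  also have "(w[0 := False, 0 := True], y[0 := True]) \<in> (class_arcs m n i)\<^sup>*"
    using y w n len_w nth_w
    by (intro class_path_free_coordinates colour_pivot) (auto simp: pivot_update_0 nth_list_update)
  also have "(y[0 := True], y[0 := True, 0 := y ! 0]) \<in> (class_arcs m n i)\<^sup>*"
    using y n by (intro class_path_update_0) (auto simp: pivot_update_0)
  finally show ?thesis
    by simp
qed

text \<open>Every label occurs in the other half, so one flip corrects the syndrome there. The
  flipped coordinate has label 0 in the current half, so the colour is preserved.\<close>

lemma class_path_to_pivot:
  assumes n: "4 * 2 ^ m \<le> n" and x: "length x = n" "colour m x = i"
  shows "\<exists>g. pivot m i g \<and> length g = n \<and> (x, g) \<in> (class_arcs m n i)\<^sup>*"
proof -
  define s where "s = x ! 0"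
  define t where "t = xor (syndrome (label m (\<not> s)) x) i"
  have t: "t < 2 ^ m"
    using x(2) by (auto simp: t_def intro!: xor_less_two_power syndrome_less label_less colour_less)
  \<comment> \<open>The copy \<open>True\<close> keeps \<open>p\<close> away from coordinate 0 even
    when \<open>t = 0\<close>, so that case needs no separate treatment.\<close>
  define p where "p = coord (\<not> s) True t"
  have p: "p < n" "p \<noteq> 0"
    using coord_less[OF t n] by (simp add: p_def) (simp add: p_def coord_def)
  have "syndrome (label m (\<not> s)) (flip p x) = i"
    using x p t by (simp add: syndrome_flip p_def label_coord) (simp add: t_def xor.commute xor.left_commute)
  moreover have "syndrome (label m s) (flip p x) = i"
    using x p t by (simp add: syndrome_flip p_def label_coord) (simp add: s_def colour_def)
  ultimately have "pivot m i (flip p x)"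
    unfolding pivot_def by (cases s) (auto simp: all_bool_eq)
  then show ?thesis
    using x p colour_pivot hypercube_arc_flip[of x n p]
    by (intro exI[of _ "flip p x"]) (auto simp: class_arcs_def)
qed

lemma class_connected:
  assumes "4 * 2 ^ m \<le> n" "length x = n" "length y = n" "colour m x = i" "colour m y = i"
  shows "(x, y) \<in> (class_arcs m n i)\<^sup>*"
proof -
  have "n > 0"
    using assms(1) by (metis gr0I le_zero_eq mult_eq_0_iff power_not_zero zero_neq_numeral)
  obtain g h where "pivot m i g" "length g = n" "(x, g) \<in> (class_arcs m n i)\<^sup>*"
    and "pivot m i h" "length h = n" "(y, h) \<in> (class_arcs m n i)\<^sup>*"
    using class_path_to_pivot assms by metis
  moreover from this have "(g, h) \<in> (class_arcs m n i)\<^sup>*"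
    using class_path_pivots \<open>n > 0\<close> by blast
  ultimately show ?thesis
    using sym_class_arcs[THEN sym_rtrancl, THEN symD] by (meson rtrancl_trans)
qed

text \<open>
  The comparison of colours lets the two ends of an edge between two classes use different copies
  of a label, so that no edge attaches both of its ends as leaves.
\<close>

definition attach_pos :: "nat \<Rightarrow> nat \<Rightarrow> bool list \<Rightarrow> nat" where
  "attach_pos m i x = coord (x ! 0) (colour m x < i) (xor (colour m x) i)"

lemma attach_pos:
  assumes "4 * 2 ^ m \<le> n" "length x = n" "i < 2 ^ m" "colour m x \<noteq> i"
  shows "attach_pos m i x < n" "flip (attach_pos m i x) x ! 0 = x ! 0"
    "colour m (flip (attach_pos m i x) x) = i"
proof -
  have t: "xor (colour m x) i < 2 ^ m"
    using assms by (intro xor_less_two_power colour_less)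
  \<comment> \<open>A nonzero label cannot sit at coordinate 0, so the attaching flip stays in its
    half and adds exactly the difference of the two colours.\<close>
  have "xor (colour m x) i \<noteq> 0"
    using assms(4) by (metis xor.assoc xor.right_neutral xor_self_eq)
  then have "attach_pos m i x \<noteq> 0"
    by (simp add: attach_pos_def coord_def)
  moreover show less: "attach_pos m i x < n"
    using coord_less[OF t assms(1)] by (simp add: attach_pos_def)
  ultimately show zero: "flip (attach_pos m i x) x ! 0 = x ! 0"
    using assms(2) by (simp add: nth_flip)
  have "colour m (flip (attach_pos m i x) x) = xor (xor (colour m x) i) (colour m x)"
    unfolding colour_def[of m "flip _ _"] zero using less assms(2) t
    by (simp add: syndrome_flip) (simp add: attach_pos_def label_coord colour_def)
  then show "colour m (flip (attach_pos m i x) x) = i"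
    by (simp add: xor.commute xor.left_commute)
qed

section \<open>The trees in the hypercube and the linear bound\<close>

lemma hypercube_completely_independent_spanning_trees:
  assumes n: "4 * 2 ^ m \<le> n"
  shows "\<exists>S. finite S \<and> completely_independent_spanning_trees (hypercube n) S \<and> card S = 2 ^ m"
proof -
  define f where "f i x = flip (attach_pos m i x) x" for i x
  have f: "length (f i x) = n" "(x, f i x) \<in> parcs (hypercube n)" "colour m (f i x) = i"
    if "i < 2 ^ m" "length x = n" "colour m x \<noteq> i" for i x
    using attach_pos[OF n that(2,1,3)] that by (simp_all add: f_def hypercube_arc_flip)
  have verts: "pverts (hypercube n) = {x. length x = n}"
    by (simp add: hypercube_def)
  have "\<exists>S. finite S \<and> completely_independent_spanning_trees (hypercube n) S \<and> card S = card {..<(2::nat) ^ m}"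
  proof (rule completely_independent_spanning_trees_of_colouring[where col = "colour m" and f = f])
    show "\<exists>x \<in> pverts (hypercube n). colour m x = i" if "i \<in> {..<2 ^ m}" for i
      using f[of i "replicate n False"] that unfolding verts by (cases "colour m (replicate n False) = i") force+
    show "(x, y) \<in> {(x, y) \<in> parcs (hypercube n). colour m x = i \<and> colour m y = i}\<^sup>*"
      if "x \<in> pverts (hypercube n)" "y \<in> pverts (hypercube n)" "colour m x = i" "colour m y = i" for i x y
      using class_connected[OF n] that by (simp add: verts class_arcs_def)
    show "(x, f i x) \<in> parcs (hypercube n) \<and> colour m (f i x) = i"
      if "i \<in> {..<2 ^ m}" "x \<in> pverts (hypercube n)" "colour m x \<noteq> i" for i x
      using f that by (simp add: verts)
    show "f (colour m x) (f i x) \<noteq> x"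
      if "i \<in> {..<2 ^ m}" "x \<in> pverts (hypercube n)" "colour m x \<noteq> i" for i x
    proof -
      have i: "i < 2 ^ m" and x: "length x = n"
        using that by (simp_all add: verts)
      \<comment> \<open>Both ends lie in the same half and need the same label. The comparison of
        colours is reversed at the other end, which selects the other copy, so the second flip
        cannot undo the first.\<close>
      have "attach_pos m (colour m x) (f i x) = coord (x ! 0) (i < colour m x) (xor i (colour m x))"
        using attach_pos(2,3)[OF n x i that(3)] by (simp add: attach_pos_def f_def)
      then have "attach_pos m (colour m x) (f i x) \<noteq> attach_pos m i x"
        using that(3) by (auto simp: attach_pos_def coord_def xor.commute)
      moreover have "attach_pos m (colour m x) (f i x) < n"
        using f[OF i x that(3)] that(3) by (intro attach_pos(1)[OF n]) (auto simp: colour_less)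
      ultimately show ?thesis
        using attach_pos(1)[OF n x i that(3)] x by (simp add: f_def flip_flip_neq)
    qed
  qed (simp_all add: pair_graph_hypercube)
  then show ?thesis
    by simp
qed

theorem theorem1:
  shows "\<exists>(c::real) (n0::nat). c > 0 \<and>
    (\<forall>n\<ge>n0. \<exists>S. finite S \<and> completely_independent_spanning_trees (hypercube n) S \<and>
      real (card S) \<ge> c * real n)"
proof (intro exI[of _ "1 / 8"] exI[of _ 4] conjI allI impI)
  fix n :: nat assume "n \<ge> 4"
  \<comment> \<open>The largest power of two not exceeding \<open>n div 4\<close>;
    \<open>n \<ge> 4\<close> makes that quotient positive. Rounding down to a power of two loses
    less than a factor 2, which with the factor 4 gives the constant 1/8.\<close>
  then obtain m where m: "2 ^ m \<le> n div 4" "n div 4 < 2 ^ (m + 1)"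
    using ex_power_ivl1[of 2 "n div 4"] by (force simp: Suc_le_eq div_greater_zero_iff)
  have "4 * 2 ^ m \<le> n" "n \<le> 8 * 2 ^ m"
    using m by auto
  then obtain S where S: "finite S" "completely_independent_spanning_trees (hypercube n) S"
      "card S = 2 ^ m"
    using hypercube_completely_independent_spanning_trees by metis
  have "1 / 8 * real n \<le> real (card S)"
    using of_nat_mono[OF \<open>n \<le> 8 * 2 ^ m\<close>, where 'a = real] S(3) by simp
  then show "\<exists>S. finite S \<and> completely_independent_spanning_trees (hypercube n) S \<and>
      real (card S) \<ge> 1 / 8 * real n"
    using S by blast
qed simp

end
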